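(* Every Šoltés' hypergraph has order at least $5$; up to isomorphism there is exactly one Šoltés' hypergraph of order $5$; and for every integer $n \ge 5$ there exists a Šoltés' hypergraph of order $n$.
   Context: A hypergraph $H=(V,E)$ consists of a finite vertex set $V$ and a set $E\subseteq 2^V$ of (hyper)edges, each edge being a set of at least two vertices (edges of different sizes are allowed, and $E$ is a set, so there are no repeated edges). The order of $H$ is $|V|$. For $v\in V$, $H\setminus v$ denotes the hypergraph with vertex set $V\setminus\{v\}$ whose edges are exactly the edges of $H$ that do not contain $v$ (so $v$ and all edges containing it are removed). The distance $d(u,v)$ is the length $r$ of a shortest path $(v_0,e_1,v_1,\ldots,e_r,v_r)$ with $v_0=u$, $v_r=v$ and each $e_i$ an edge containing $v_{i-1}$ and $v_i$, no vertex or edge being repeated; it is infinite if there is no such path. $H$ is connected if all distances are finite. The total distance is $W(H)=\sum d(u,v)$, summed over all unordered pairs of distinct vertices. A Šoltés' hypergraph is a connected hypergraph $H$ such that $W(H\setminus v)$ is finite and $W(H)=W(H\setminus v)$ for every $v\in V$; by convention the one-vertex hypergraph $K_1$ is not a Šoltés' hypergraph, so a Šoltés' hypergraph has at least two vertices. *)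

theory Defs
  imports "HOL-Library.Extended_Nat"
begin

record 'a hypergraph =
  verts :: "'a set"
  edges :: "'a set set"

definition hypergraph :: "'a hypergraph \<Rightarrow> bool" where
  "hypergraph H \<longleftrightarrow> finite (verts H) \<and> (\<forall>e\<in>edges H. e \<subseteq> verts H \<and> 2 \<le> card e)"

definition hg_order :: "'a hypergraph \<Rightarrow> nat" where
  "hg_order H = card (verts H)"

definition del_vert :: "'a hypergraph \<Rightarrow> 'a \<Rightarrow> 'a hypergraph" where
  "del_vert H v = \<lparr>verts = verts H - {v}, edges = {e \<in> edges H. v \<notin> e}\<rparr>"

definition isomorphic :: "'a hypergraph \<Rightarrow> 'b hypergraph \<Rightarrow> bool" where
  "isomorphic G H \<longleftrightarrow>
     (\<exists>f. bij_betw f (verts G) (verts H) \<and> edges H = (\<lambda>e. f ` e) ` edges G)"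

(* The path (v_0, e_1, v_1, ..., e_r, v_r) is the pair of lists vs = [v_0, ..., v_r] and
   es = [e_1, ..., e_r]; list indices start at 0, so es ! i is e_(i+1). *)
definition hg_path :: "'a hypergraph \<Rightarrow> 'a \<Rightarrow> 'a list \<Rightarrow> 'a set list \<Rightarrow> 'a \<Rightarrow> bool" where
  "hg_path H u vs es v \<longleftrightarrow>
     length vs = Suc (length es) \<and> hd vs = u \<and> last vs = v \<and>
     set vs \<subseteq> verts H \<and> set es \<subseteq> edges H \<and> distinct vs \<and> distinct es \<and>
     (\<forall>i<length es. vs ! i \<in> es ! i \<and> vs ! Suc i \<in> es ! i)"

(* If there is no path, this is the infimum of the empty set, which is \<infinity>. *)
definition distance :: "'a hypergraph \<Rightarrow> 'a \<Rightarrow> 'a \<Rightarrow> enat" where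
  "distance H u v = Inf {enat (length es) | vs es. hg_path H u vs es v}"

definition hg_connected :: "'a hypergraph \<Rightarrow> bool" where
  "hg_connected H \<longleftrightarrow> (\<forall>u\<in>verts H. \<forall>v\<in>verts H. distance H u v \<noteq> \<infinity>)"

(* The infimum ranges over the two orderings (u, v) of the pair P; both give the same distance,
   see pair_distance_eq below. *)
definition pair_distance :: "'a hypergraph \<Rightarrow> 'a set \<Rightarrow> enat" where
  "pair_distance H P = Inf {distance H u v | u v. P = {u, v}}"

definition total_distance :: "'a hypergraph \<Rightarrow> enat" where
  "total_distance H = (\<Sum>P | P \<subseteq> verts H \<and> card P = 2. pair_distance H P)"

definition soltes :: "'a hypergraph \<Rightarrow> bool" where
  "soltes H \<longleftrightarrow>
     hypergraph H \<and> 2 \<le> hg_order H \<and> hg_connected H \<and>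
     (\<forall>v\<in>verts H. total_distance (del_vert H v) \<noteq> \<infinity> \<and>
                  total_distance H = total_distance (del_vert H v))"

lemma hg_path_rev:
  assumes "hg_path H u vs es v"
  shows "hg_path H v (rev vs) (rev es) u"
proof -
  have len: "length vs = Suc (length es)" and ne: "vs \<noteq> []"
    using assms by (auto simp: hg_path_def)
  have "rev vs ! i \<in> rev es ! i \<and> rev vs ! Suc i \<in> rev es ! i" if i: "i < length es" for i
  proof -
    define j where "j = length es - Suc i"
    have j: "j < length es" "length vs - Suc i = Suc j" "length vs - Suc (Suc i) = j"
      using i len by (auto simp: j_def)
    have "vs ! j \<in> es ! j \<and> vs ! Suc j \<in> es ! j"
      using assms j(1) by (simp add: hg_path_def)
    moreover have "rev es ! i = es ! j" using i by (simp add: rev_nth j_def)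
    moreover have "rev vs ! i = vs ! Suc j" "rev vs ! Suc i = vs ! j"
      using i len j by (simp_all add: rev_nth)
    ultimately show ?thesis by simp
  qed
  then show ?thesis
    using assms ne by (simp add: hg_path_def hd_rev last_rev)
qed

lemma distance_commute: "distance H u v = distance H v u"
proof -
  have "{enat (length es) | vs es. hg_path H a vs es b} \<subseteq>
        {enat (length es) | vs es. hg_path H b vs es a}" for a b
    proof
      fix x assume "x \<in> {enat (length es) | vs es. hg_path H a vs es b}"
      then obtain vs es where "x = enat (length es)" "hg_path H a vs es b" by blast
      then have "x = enat (length (rev es))" "hg_path H b (rev vs) (rev es) a"
        by (simp_all add: hg_path_rev)
      then show "x \<in> {enat (length es) | vs es. hg_path H b vs es a}" by blast
    qed
  then show ?thesis
    unfolding distance_def by (intro arg_cong[where f = Inf] subset_antisym)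
qed

lemma pair_distance_eq: "pair_distance H {u, v} = distance H u v"
proof -
  have "{distance H a b | a b. {u, v} = {a, b}} = {distance H u v}"
    by (auto simp: doubleton_eq_iff distance_commute)
  then show ?thesis
    by (simp add: pair_distance_def)
qed

end

theory Submission
  imports Defs
begin

text \<open>Two vertices are called adjacent if they share an edge. The distance in a hypergraph is the walk
metric of the adjacency relation (\<open>distance_le_iff\<close>), so everything below is about adjacency.

The bounds come from comparing extremes. Before a deletion each of the \<open>n choose 2\<close> pairs contributes
at least 1 to the total distance; after it, \<open>n - 1\<close> vertices cannot have a larger total distance than
a path on them has, which is \<open>n choose 3\<close>. Hence \<open>n\<close> is at least 5. At \<open>n = 5\<close> both numbers
are 10, and since the path is the only maximiser on four vertices (\<open>farthest_on_4_is_path\<close>), every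
vertex-deleted hypergraph is a path and every pair of vertices shares an edge. This leaves
the pentagon together with the edge of all five vertices (\<open>soltes_order_5_structure\<close>).

For existence the edge of all vertices is kept. It makes all distances 1, and it is lost with every
deletion. The remaining edges then have to be chosen such that each deletion leaves a total
distance of \<open>n choose 2\<close>, which is \<open>n - 1\<close> above the number of remaining pairs
(\<open>soltes_if_excess\<close>). For \<open>n \<ge> 8\<close> a hypergraph with cyclic symmetry achieves this: it has
diameter 2 after a deletion, and exactly \<open>n - 1\<close> pairs are then not adjacent (\<open>soltes_circulant\<close>). For
\<open>n = 5, 6, 7\<close> explicit examples are checked by evaluation.\<close>

section \<open>Adjacency, walks and distance\<close>

definition adj :: "'a hypergraph \<Rightarrow> 'a \<Rightarrow> 'a \<Rightarrow> bool" where
  "adj H u v \<longleftrightarrow> (\<exists>e\<in>edges H. u \<in> e \<and> v \<in> e)"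

lemma adj_verts: "hypergraph H \<Longrightarrow> adj H u v \<Longrightarrow> u \<in> verts H \<and> v \<in> verts H"
  by (auto simp: adj_def hypergraph_def)

lemma walk_of_path:
  assumes "hg_path H u vs es v"
  shows "(adj H ^^ length es) u v"
proof -
  have "vs \<noteq> []" and "length vs = Suc (length es)"
    using assms by (auto simp: hg_path_def)
  then have "vs ! 0 = u" "vs ! length es = v"
    using assms by (auto simp: hg_path_def hd_conv_nth last_conv_nth)
  moreover have "\<forall>i<length es. adj H (vs ! i) (vs ! Suc i)"
    using assms unfolding hg_path_def adj_def by (meson nth_mem subsetD)
  ultimately show ?thesis
    unfolding relpowp_fun_conv by blast
qed

text \<open>A walk may repeat vertices and edges, but a shortest one may not: a repeated vertex, or an edge
used twice, would let the walk jump ahead. So the ban on repetitions in paths does not affect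
distances, and distance is the walk metric of the graph of pairs that share an edge.\<close>

lemma path_of_shortest_walk:
  assumes H: "hypergraph H" and u: "u \<in> verts H"
    and walk: "(adj H ^^ k) u v"
    and shortest: "\<And>j. j < k \<Longrightarrow> \<not> (adj H ^^ j) u v"
  shows "\<exists>vs es. hg_path H u vs es v \<and> length es = k"
proof -
  obtain f where f0: "f 0 = u" and fk: "f k = v"
    and fs: "\<And>i. i < k \<Longrightarrow> adj H (f i) (f (Suc i))"
    using walk unfolding relpowp_fun_conv by blast
  then have "\<forall>i. \<exists>e. i < k \<longrightarrow> e \<in> edges H \<and> f i \<in> e \<and> f (Suc i) \<in> e"
    unfolding adj_def by blast
  then obtain g where g: "\<And>i. i < k \<Longrightarrow> g i \<in> edges H \<and> f i \<in> g i \<and> f (Suc i) \<in> g i"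
    by metis
  have before: "(adj H ^^ i) u (f i)" if "i \<le> k" for i
    unfolding relpowp_fun_conv using f0 fs that by (intro exI[of _ f]) auto
  have after: "(adj H ^^ (k - i)) (f i) v" if "i \<le> k" for i
    unfolding relpowp_fun_conv using fk fs that by (intro exI[of _ "\<lambda>j. f (i + j)"]) auto
  have no_shortcut: False
    if "(adj H ^^ m) (f i) (f j)" "i + m < j" "j \<le> k" for i j m
  proof -
    have "(adj H ^^ (i + m)) u (f j)"
      using before[of i] that by (auto simp: relpowp_add)
    then have "(adj H ^^ (i + m + (k - j))) u v"
      using after[of j] that by (subst relpowp_add) auto
    moreover have "i + m + (k - j) < k"
      using that by linarith
    ultimately show False using shortest by blast
  qed
  have f_ne: "f i \<noteq> f j" if "i < j" "j \<le> k" for i j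
    using no_shortcut[of 0 i j] that by auto
  have g_ne: "g i \<noteq> g j" if "i < j" "j < k" for i j
  proof
    assume "g i = g j"
    then have "adj H (f i) (f (Suc j))"
      using g[of i] g[of j] that unfolding adj_def by auto
    then show False using no_shortcut[of 1 i "Suc j"] that by (auto simp: relpowp_1)
  qed
  have "inj_on f {0..<Suc k}"
    using f_ne by (intro linorder_inj_onI) auto
  moreover have "inj_on g {0..<k}"
    using g_ne by (intro linorder_inj_onI) auto
  moreover have "f i \<in> verts H" if "i \<le> k" for i
  proof (cases i)
    case 0 then show ?thesis using f0 u by simp
  next
    case (Suc j) then show ?thesis using fs[of j] adj_verts[OF H] that by simp
  qed
  ultimately have "hg_path H u (map f [0..<Suc k]) (map g [0..<k]) v"
    using f0 fk g
    by (auto simp: hg_path_def distinct_map hd_map hd_upt simp del: upt_Suc)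
      (auto simp: last_conv_nth simp del: upt_Suc)
  then show ?thesis
    by (intro exI) auto
qed

lemma distance_attained:
  assumes "distance H u v \<noteq> \<infinity>"
  obtains vs es where "hg_path H u vs es v" "distance H u v = enat (length es)"
proof -
  let ?S = "{enat (length es) | vs es. hg_path H u vs es v}"
  have "?S \<noteq> {}"
    using assms unfolding distance_def Inf_enat_def by metis
  then have "Inf ?S \<in> ?S"
    by (metis (no_types, lifting) Inf_enat_def LeastI_ex ex_in_conv)
  then show thesis
    using that unfolding distance_def by blast
qed

lemma distance_le_iff:
  assumes H: "hypergraph H" and u: "u \<in> verts H"
  shows "distance H u v \<le> enat k \<longleftrightarrow> (\<exists>j\<le>k. (adj H ^^ j) u v)"
proof
  assume le: "distance H u v \<le> enat k"
  then have "distance H u v \<noteq> \<infinity>"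
    by (cases "distance H u v") auto
  then obtain vs es where "hg_path H u vs es v" "distance H u v = enat (length es)"
    by (rule distance_attained)
  then show "\<exists>j\<le>k. (adj H ^^ j) u v"
    using le walk_of_path by (intro exI[of _ "length es"]) auto
next
  assume "\<exists>j\<le>k. (adj H ^^ j) u v"
  then obtain j where j: "j \<le> k" "(adj H ^^ j) u v" by blast
  define l where "l = (LEAST l. (adj H ^^ l) u v)"
  have "(adj H ^^ l) u v" "\<And>i. i < l \<Longrightarrow> \<not> (adj H ^^ i) u v" "l \<le> j"
    using j unfolding l_def by (auto intro: LeastI Least_le dest: not_less_Least)
  with path_of_shortest_walk[OF H u] obtain vs es
    where "hg_path H u vs es v" "length es = l" by blast
  then have "distance H u v \<le> enat l"
    unfolding distance_def by (intro Inf_lower) auto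
  then show "distance H u v \<le> enat k"
    using j \<open>l \<le> j\<close> by (meson enat_ord_simps(1) order_trans)
qed

lemma distance_less_order:
  assumes H: "hypergraph H" and fin: "distance H u v \<noteq> \<infinity>"
  shows "distance H u v < enat (hg_order H)"
proof -
  obtain vs es where p: "hg_path H u vs es v" "distance H u v = enat (length es)"
    using fin by (rule distance_attained)
  have "Suc (length es) \<le> hg_order H"
    using H p card_mono[of "verts H" "set vs"] distinct_card[of vs]
    by (auto simp: hg_path_def hg_order_def hypergraph_def)
  then show ?thesis
    using p by simp
qed

lemma distance_le_0_iff:
  assumes "hypergraph H" "u \<in> verts H"
  shows "distance H u v \<le> 0 \<longleftrightarrow> u = v"
  using distance_le_iff[OF assms, of v 0] by (simp add: zero_enat_def)

lemma ex_le_Suc: "(\<exists>j\<le>Suc k. P j) \<longleftrightarrow> (\<exists>j\<le>k. P j) \<or> P (Suc k)"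
  by (metis le_Suc_eq)

lemma distance_le_1_iff:
  assumes "hypergraph H" "u \<in> verts H"
  shows "distance H u v \<le> 1 \<longleftrightarrow> u = v \<or> adj H u v"
  using distance_le_iff[OF assms, of v 1]
  by (simp add: one_enat_def ex_le_Suc relpowp_1 del: relpowp.simps(2))

lemma distance_le_2_iff:
  assumes "hypergraph H" "u \<in> verts H"
  shows "distance H u v \<le> 2 \<longleftrightarrow> u = v \<or> adj H u v \<or> (\<exists>w. adj H u w \<and> adj H w v)"
  using distance_le_iff[OF assms, of v 2]
  by (simp add: numeral_2_eq_2 numeral_eq_enat ex_le_Suc relpowp_1 relpowp_Suc_left) (auto simp: OO_def)

lemma distance_le_3_iff:
  assumes "hypergraph H" "u \<in> verts H"
  shows "distance H u v \<le> 3 \<longleftrightarrow> u = v \<or> adj H u v \<or> (\<exists>w. adj H u w \<and> adj H w v)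
     \<or> (\<exists>w x. adj H u w \<and> adj H w x \<and> adj H x v)"
  using distance_le_iff[OF assms, of v 3]
  by (simp add: numeral_3_eq_3 numeral_eq_enat ex_le_Suc relpowp_1) (auto simp add: OO_def)

section \<open>Total distance as a count of far pairs\<close>

definition pairs :: "'a::linorder set \<Rightarrow> ('a \<times> 'a) set" where
  "pairs V = {(x, y). x \<in> V \<and> y \<in> V \<and> x < y}"

lemma finite_pairs [simp]: "finite V \<Longrightarrow> finite (pairs V)"
  by (rule finite_subset[of _ "V \<times> V"]) (auto simp: pairs_def)

lemma bij_betw_pairs:
  "bij_betw (\<lambda>(x, y). {x, y}) (pairs V) {P. P \<subseteq> V \<and> card P = 2}"
proof (rule bij_betwI')
  fix p q assume "p \<in> pairs V" "q \<in> pairs V"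
  then show "((case p of (x, y) \<Rightarrow> {x, y}) = (case q of (x, y) \<Rightarrow> {x, y})) = (p = q)"
    by (auto simp: pairs_def doubleton_eq_iff)
next
  fix p assume "p \<in> pairs V"
  then show "(case p of (x, y) \<Rightarrow> {x, y}) \<in> {P. P \<subseteq> V \<and> card P = 2}"
    by (auto simp: pairs_def)
next
  fix P assume "P \<in> {P. P \<subseteq> V \<and> card P = 2}"
  then obtain a b where "P = {a, b}" "a \<noteq> b" "a \<in> V" "b \<in> V"
    by (auto simp: card_2_iff)
  then have "(a, b) \<in> pairs V \<or> (b, a) \<in> pairs V" "P = {a, b}" "P = {b, a}"
    by (auto simp: pairs_def)
  then show "\<exists>p\<in>pairs V. P = (case p of (x, y) \<Rightarrow> {x, y})"
    by fastforce
qed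

lemma card_pairs: "finite V \<Longrightarrow> card (pairs V) = card V choose 2"
  using bij_betw_same_card[OF bij_betw_pairs, of V] n_subsets[of V 2] by simp

text \<open>On a linearly ordered vertex type unordered pairs can be represented by increasing ordered pairs,
which are easier to count.\<close>

lemma total_distance_pairs:
  "total_distance H = (\<Sum>(x, y)\<in>pairs (verts H). distance H x y)"
proof -
  have "total_distance H = (\<Sum>p\<in>pairs (verts H). pair_distance H (case p of (x, y) \<Rightarrow> {x, y}))"
    unfolding total_distance_def by (rule sum.reindex_bij_betw[OF bij_betw_pairs, symmetric])
  then show ?thesis
    by (simp add: pair_distance_eq split_def)
qed

lemma sum_enat: "(\<Sum>x\<in>A. enat (f x)) = enat (\<Sum>x\<in>A. f x)"
  by (induction A rule: infinite_finite_induct) (auto simp: zero_enat_def)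

lemma enat_within_3:
  fixes d :: enat
  assumes "0 < d" "d \<le> 3"
  shows "d = enat (1 + of_bool (\<not> d \<le> 1) + of_bool (\<not> d \<le> 2))"
proof -
  obtain k where k: "d = enat k" using assms by (cases d) auto
  then have "k = 1 \<or> k = 2 \<or> k = 3"
    using assms by (auto simp: numeral_eq_enat zero_enat_def)
  then show ?thesis
    using k by (auto simp: numeral_eq_enat one_enat_def)
qed

text \<open>A distance of at most 3 is 1, plus 1 if it exceeds 1, plus 1 if it exceeds 2. Hence the total
distance is the number of pairs plus an excess obtained by counting far pairs, and no distance has
to be computed exactly.\<close>

lemma total_distance_within_3:
  fixes H :: "'a::linorder hypergraph"
  assumes H: "hypergraph H"
    and within: "\<And>x y. x \<in> verts H \<Longrightarrow> y \<in> verts H \<Longrightarrow> x < y \<Longrightarrow> distance H x y \<le> 3"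
  shows "total_distance H = enat ((hg_order H choose 2)
      + card {(x, y) \<in> pairs (verts H). \<not> distance H x y \<le> 1}
      + card {(x, y) \<in> pairs (verts H). \<not> distance H x y \<le> 2})"
proof -
  let ?P = "pairs (verts H)"
  have fin: "finite (verts H)" using H by (simp add: hypergraph_def)
  have card_far: "(\<Sum>(x, y)\<in>?P. of_bool (\<not> distance H x y \<le> k))
      = card {(x, y) \<in> ?P. \<not> distance H x y \<le> k}" for k
    using finite_pairs[OF fin]
    by (simp add: split_def of_bool_def sum.If_cases Int_def del: finite_pairs)
  have "total_distance H = (\<Sum>(x, y)\<in>?P. enat (1 + of_bool (\<not> distance H x y \<le> 1)
      + of_bool (\<not> distance H x y \<le> 2)))"
    unfolding total_distance_pairs
  proof (rule sum.cong[OF refl], clarify)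
    fix x y assume "(x, y) \<in> ?P"
    then have "x \<in> verts H" "y \<in> verts H" "x < y" by (auto simp: pairs_def)
    moreover from this have "0 < distance H x y"
      using distance_le_0_iff[OF H, of x y] by (auto simp: zero_less_iff_neq_zero)
    ultimately show "distance H x y = enat (1 + of_bool (\<not> distance H x y \<le> 1)
      + of_bool (\<not> distance H x y \<le> 2))"
      using within by (intro enat_within_3) auto
  qed
  also have "\<dots> = enat (\<Sum>(x, y)\<in>?P. 1 + of_bool (\<not> distance H x y \<le> 1)
      + of_bool (\<not> distance H x y \<le> 2))"
    by (simp only: sum_enat split_def)
  also have "(\<Sum>(x, y)\<in>?P. 1 + of_bool (\<not> distance H x y \<le> 1) + of_bool (\<not> distance H x y \<le> 2))
    = card ?P + card {(x, y) \<in> ?P. \<not> distance H x y \<le> 1} + card {(x, y) \<in> ?P. \<not> distance H x y \<le> 2}"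
    unfolding card_far[symmetric] by (simp add: split_def sum.distrib sum_Suc del: sum_of_bool_eq)
  finally show ?thesis
    using fin by (simp add: card_pairs hg_order_def)
qed

lemma verts_del_vert [simp]: "verts (del_vert H v) = verts H - {v}"
  by (simp add: del_vert_def)

lemma hypergraph_del_vert: "hypergraph H \<Longrightarrow> hypergraph (del_vert H v)"
  by (auto simp: hypergraph_def del_vert_def)

lemma hg_order_del_vert: "hypergraph H \<Longrightarrow> v \<in> verts H \<Longrightarrow> hg_order (del_vert H v) = hg_order H - 1"
  by (auto simp: hypergraph_def del_vert_def hg_order_def)

text \<open>When the whole vertex set is an edge, all distances are 1. Deleting any vertex destroys this edge,
so the condition at each vertex only concerns the other edges.\<close>

lemma soltesI:
  fixes H :: "'a::linorder hypergraph"
  assumes H: "hypergraph H" and order: "2 \<le> hg_order H" and full: "verts H \<in> edges H"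
    and del: "\<And>v. v \<in> verts H \<Longrightarrow> total_distance (del_vert H v) = enat (hg_order H choose 2)"
  shows "soltes H"
proof -
  have near: "distance H x y \<le> 1" if "x \<in> verts H" "y \<in> verts H" for x y
    using distance_le_1_iff[OF H that(1)] that full by (auto simp: adj_def)
  then have 2: "distance H x y \<le> 2 \<and> distance H x y \<le> 3" if "x \<in> verts H" "y \<in> verts H" for x y
    using that by (meson order_trans one_le_numeral)
  have none: "{(x, y). (x, y) \<in> pairs (verts H) \<and> \<not> distance H x y \<le> 1} = {}"
    "{(x, y). (x, y) \<in> pairs (verts H) \<and> \<not> distance H x y \<le> 2} = {}"
    using near 2 by (auto simp: pairs_def)
  have "total_distance H = enat (hg_order H choose 2)"
    using total_distance_within_3[OF H] 2 unfolding none by simp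
  moreover have "hg_connected H"
    unfolding hg_connected_def using near by (metis enat_ord_code(5) one_enat_def)
  ultimately show ?thesis
    using H order del by (simp add: soltes_def)
qed

text \<open>The target \<open>n choose 2\<close> exceeds the number \<open>(n - 1) choose 2\<close> of pairs that survive a deletion by
\<open>n - 1\<close>, so this must be the excess of every vertex-deleted hypergraph.\<close>

lemma soltes_if_excess:
  fixes H :: "'a::linorder hypergraph"
  assumes H: "hypergraph H" and order: "2 \<le> hg_order H" and full: "verts H \<in> edges H"
    and within: "\<And>v x y. v \<in> verts H \<Longrightarrow> (x, y) \<in> pairs (verts H - {v}) \<Longrightarrow> distance (del_vert H v) x y \<le> 3"
    and excess: "\<And>v. v \<in> verts H \<Longrightarrow>
      card {(x, y) \<in> pairs (verts H - {v}). \<not> distance (del_vert H v) x y \<le> 1} +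
      card {(x, y) \<in> pairs (verts H - {v}). \<not> distance (del_vert H v) x y \<le> 2} = hg_order H - 1"
  shows "soltes H"
proof (rule soltesI[OF H order full])
  fix v assume v: "v \<in> verts H"
  obtain m where m: "hg_order H = Suc (Suc m)"
    using order by (metis add_2_eq_Suc le_Suc_ex)
  have "total_distance (del_vert H v) = enat (((hg_order H - 1) choose 2) + (hg_order H - 1))"
    using total_distance_within_3[OF hypergraph_del_vert[OF H, of v]] within[OF v] excess[OF v]
    by (simp add: hg_order_del_vert[OF H v] add.assoc) (auto simp: pairs_def)
  also have "((hg_order H - 1) choose 2) + (hg_order H - 1) = hg_order H choose 2"
    using m by (simp add: numeral_2_eq_2)
  finally show "total_distance (del_vert H v) = enat (hg_order H choose 2)" .
qed

section \<open>Extremal bounds and orders below five\<close>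

lemma sum_pairs_of_4:
  assumes "distinct [a, b, c, d]"
  shows "(\<Sum>P | P \<subseteq> {a, b, c, d} \<and> card P = 2. g P) =
    g {a, b} + g {b, c} + g {c, d} + g {a, c} + g {b, d} + g {a, d}"
proof -
  have "{P. P \<subseteq> {a, b, c, d} \<and> card P = 2} = {{a, b}, {b, c}, {c, d}, {a, c}, {b, d}, {a, d}}"
    (is "?L = ?R")
  proof (intro equalityI subsetI)
    fix P assume "P \<in> ?L"
    then have "card P = 2" "P \<subseteq> {a, b, c, d}" by simp_all
    then obtain x y where "P = {x, y}" "x \<noteq> y" "x \<in> {a, b, c, d}" "y \<in> {a, b, c, d}"
      unfolding card_2_iff by blast
    then show "P \<in> ?R"
      by (elim insertE emptyE) (simp_all add: doubleton_eq_iff)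
  next
    fix P assume "P \<in> ?R"
    then show "P \<in> ?L"
      using assms by (elim insertE emptyE) simp_all
  qed
  moreover have ne: "a \<noteq> b" "a \<noteq> c" "a \<noteq> d" "b \<noteq> c" "b \<noteq> d" "c \<noteq> d"
    using assms by simp_all
  ultimately show ?thesis
    by (simp add: doubleton_eq_iff add.assoc ne ne[symmetric])
qed

lemma total_distance_of_4:
  assumes "verts H = {a, b, c, d}" "distinct [a, b, c, d]"
  shows "total_distance H = distance H a b + distance H b c + distance H c d
    + distance H a c + distance H b d + distance H a d"
  unfolding total_distance_def assms(1) sum_pairs_of_4[OF assms(2)]
  by (simp add: pair_distance_eq)

lemma total_distance_finiteD:
  assumes H: "hypergraph H" and fin: "total_distance H \<noteq> \<infinity>"
    and "u \<in> verts H" "v \<in> verts H" "u \<noteq> v"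
  shows "distance H u v \<noteq> \<infinity>"
proof -
  have "finite {P. P \<subseteq> verts H \<and> card P = 2}"
    using H by (auto simp: hypergraph_def)
  then have "pair_distance H {u, v} \<le> total_distance H"
    unfolding total_distance_def using assms by (intro member_le_sum) auto
  then have le: "distance H u v \<le> total_distance H"
    by (simp add: pair_distance_eq)
  show ?thesis
  proof
    assume "distance H u v = \<infinity>"
    then show False using le fin by simp
  qed
qed

lemma distance_less_orderD:
  assumes "hypergraph H" "total_distance H \<noteq> \<infinity>" "u \<in> verts H" "v \<in> verts H" "u \<noteq> v"
  obtains k where "distance H u v = enat k" "0 < k" "k < hg_order H"
proof -
  have "distance H u v < enat (hg_order H)"
    using distance_less_order total_distance_finiteD assms by metis
  moreover have "\<not> distance H u v \<le> 0"
    using distance_le_0_iff assms by metis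
  ultimately show thesis
    using that by (cases "distance H u v") (auto simp: zero_enat_def)
qed

text \<open>Each pair contributes at least 1. The case of equality is what forces every pair of vertices of the
order 5 hypergraph into a common edge.\<close>

lemma total_distance_ge:
  assumes H: "hypergraph H"
  shows "enat (hg_order H choose 2) \<le> total_distance H"
    and "total_distance H = enat (hg_order H choose 2) \<Longrightarrow> u \<in> verts H \<Longrightarrow> v \<in> verts H \<Longrightarrow> distance H u v \<le> 1"
proof -
  let ?S = "{P. P \<subseteq> verts H \<and> card P = 2}"
  have fin: "finite ?S" and card: "card ?S = hg_order H choose 2"
    using H n_subsets by (auto simp: hypergraph_def hg_order_def)
  have ge: "1 \<le> pair_distance H P" if "P \<in> ?S" for P
  proof -
    have "card P = 2" using that by simp
    then obtain u v where "P = {u, v}" "u \<noteq> v" by (auto simp: card_2_iff)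
    then have "P = {u, v}" "u \<noteq> v" "u \<in> verts H" using that by auto
    moreover from this have "0 < distance H u v"
      using distance_le_0_iff[OF H, of u v] by (simp add: zero_less_iff_neq_zero)
    ultimately show ?thesis
      using ileI1[of 0] by (simp add: one_eSuc pair_distance_eq)
  qed
  have "(\<Sum>P\<in>?S. 1) \<le> total_distance H"
    unfolding total_distance_def by (rule sum_mono) (rule ge)
  then show "enat (hg_order H choose 2) \<le> total_distance H"
    by (simp add: card of_nat_eq_enat)
  assume eq: "total_distance H = enat (hg_order H choose 2)" and uv: "u \<in> verts H" "v \<in> verts H"
  show "distance H u v \<le> 1"
  proof (cases "u = v")
    case True then show ?thesis
      using distance_le_1_iff[OF H uv(1)] by simp
  next
    case False
    then have mem: "{u, v} \<in> ?S" using uv by auto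
    have "(\<Sum>P\<in>?S - {{u, v}}. 1) \<le> (\<Sum>P\<in>?S - {{u, v}}. pair_distance H P)"
      by (rule sum_mono) (use ge in blast)
    then have le: "enat ((hg_order H choose 2) - 1) \<le> (\<Sum>P\<in>?S - {{u, v}}. pair_distance H P)"
      using mem fin card by (simp add: of_nat_eq_enat)
    have pos: "hg_order H choose 2 > 0"
      using mem fin card by (metis card_gt_0_iff empty_iff)
    have "distance H u v + (\<Sum>P\<in>?S - {{u, v}}. pair_distance H P) = enat (hg_order H choose 2)"
      using sum.remove[OF fin mem, of "pair_distance H"] eq by (simp add: total_distance_def pair_distance_eq)
    then show ?thesis
      using le pos by (cases "distance H u v"; cases "\<Sum>P\<in>?S - {{u, v}}. pair_distance H P") (auto simp: one_enat_def)
  qed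
qed

text \<open>Among connected hypergraphs on four vertices the path is the unique one of maximal total distance.
If no distance exceeds 2, then 10 requires at most two adjacent pairs out of six, which is
too few for all the other pairs to have a common neighbour. Otherwise a geodesic of length 3 visits
all four vertices, and the total distance can reach 10 only if its chords are missing; an edge
of more than two vertices would contain a chord.\<close>

lemma farthest_on_4_is_path:
  assumes H: "hypergraph H" and order: "hg_order H = 4"
    and fin: "total_distance H \<noteq> \<infinity>" and far: "10 \<le> total_distance H"
  obtains a b c d where "distinct [a, b, c, d]" "verts H = {a, b, c, d}"
    "edges H = {{a, b}, {b, c}, {c, d}}" "total_distance H = 10"
proof -
  note dist = distance_less_orderD[OF H fin]
  obtain p q r s where V: "verts H = {p, q, r, s}" "distinct [p, q, r, s]"
    using order unfolding hg_order_def by (auto simp: card_Suc_eq numeral_eq_Suc)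
  have "\<exists>u v. u \<in> verts H \<and> v \<in> verts H \<and> \<not> distance H u v \<le> 2"
  proof (rule ccontr)
    assume "\<not> ?thesis"
    then have two: "distance H u v \<le> 2" if "u \<in> verts H" "v \<in> verts H" for u v
      using that by blast
    have one: "distance H u v = (if adj H u v then 1 else 2)"
      if uv: "u \<in> verts H" "v \<in> verts H" "u \<noteq> v" for u v
    proof -
      obtain k where k: "distance H u v = enat k" "0 < k" using dist[OF uv] .
      then have "k \<le> 2" using two[OF uv(1,2)] by (simp add: numeral_eq_enat)
      then have "k = 1 \<or> k = 2" using k by auto
      then show ?thesis
        using k distance_le_1_iff[OF H uv(1), of v] uv
        by (auto simp: numeral_eq_enat one_enat_def)
    qed
    have mid: "adj H u v \<or> (\<exists>w\<in>verts H - {u, v}. adj H u w \<and> adj H w v)"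
      if uv: "u \<in> verts H" "v \<in> verts H" "u \<noteq> v" for u v
      using two[OF uv(1,2)] distance_le_2_iff[OF H uv(1), of v] uv adj_verts[OF H] by blast
    have sym: "adj H u v \<longleftrightarrow> adj H v u" for u v by (auto simp: adj_def)
    define x where "x u v = (if adj H u v then 1 else 2 :: nat)" for u v
    have x: "distance H u v = enat (x u v)" if "u \<in> verts H" "v \<in> verts H" "u \<noteq> v" for u v
      using one[OF that] by (simp add: x_def numeral_eq_enat one_enat_def)
    have "10 \<le> x p q + x q r + x r s + x p r + x q s + x p s"
      using far V by (simp add: total_distance_of_4[OF V] x numeral_eq_enat)
    moreover have "adj H p q \<or> adj H p r \<and> adj H q r \<or> adj H p s \<and> adj H q s"
      "adj H q r \<or> adj H p q \<and> adj H p r \<or> adj H q s \<and> adj H r s"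
      "adj H r s \<or> adj H p r \<and> adj H p s \<or> adj H q r \<and> adj H q s"
      "adj H p r \<or> adj H p q \<and> adj H q r \<or> adj H p s \<and> adj H r s"
      "adj H q s \<or> adj H p q \<and> adj H p s \<or> adj H q r \<and> adj H r s"
      "adj H p s \<or> adj H p q \<and> adj H q s \<or> adj H p r \<and> adj H r s"
      using mid[of p q] mid[of q r] mid[of r s] mid[of p r] mid[of q s] mid[of p s] V sym by auto
    \<comment> \<open>At most two of the six pairs are adjacent, against the six conditions on common neighbours.\<close>
    ultimately show False
      unfolding x_def by (auto split: if_splits)
  qed
  then obtain a d where ad: "a \<in> verts H" "d \<in> verts H" "\<not> distance H a d \<le> 2" by blast
  then have "a \<noteq> d" using distance_le_2_iff[OF H] by blast
  with ad obtain k where k: "distance H a d = enat k" "k < 4" using dist order by metis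
  then have ad3: "distance H a d = 3" using ad(3) by (auto simp: numeral_eq_enat)
  then obtain b c where walk: "adj H a b" "adj H b c" "adj H c d"
    using ad distance_le_3_iff[OF H ad(1), of d] distance_le_2_iff[OF H ad(1), of d] by auto
  have far_ends: "\<not> adj H a d" "\<And>w. \<not> (adj H a w \<and> adj H w d)"
    using ad distance_le_2_iff[OF H ad(1), of d] by auto
  have dis: "distinct [a, b, c, d]"
    using walk far_ends \<open>a \<noteq> d\<close> by auto
  have sub: "{a, b, c, d} \<subseteq> verts H"
    using walk adj_verts[OF H] by blast
  moreover have "card {a, b, c, d} = card (verts H)"
    using dis order by (simp add: hg_order_def)
  ultimately have verts: "verts H = {a, b, c, d}"
    using H card_subset_eq unfolding hypergraph_def by metis
  have le1: "distance H a b \<le> 1" "distance H b c \<le> 1" "distance H c d \<le> 1"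
    using walk distance_le_1_iff[OF H] verts by auto
  have le2: "distance H a c \<le> 2" "distance H b d \<le> 2"
    using walk distance_le_2_iff[OF H] verts by auto
  have total: "total_distance H \<le> 1 + 1 + 1 + distance H a c + distance H b d + 3"
    unfolding total_distance_of_4[OF verts dis] using le1 ad3 by (intro add_mono) auto
  have two: "distance H a c = 2" "distance H b d = 2"
    using order_trans[OF far total] le2
    by (cases "distance H a c"; cases "distance H b d"; auto simp: numeral_eq_enat one_enat_def)+
  then have nonadj: "\<not> adj H a c" "\<not> adj H b d"
    using distance_le_1_iff[OF H, of a c] distance_le_1_iff[OF H, of b d] verts by auto
  have edge: "e = {a, b} \<or> e = {b, c} \<or> e = {c, d}" if e: "e \<in> edges H" for e
  proof -
    have "\<not> (a \<in> e \<and> c \<in> e)" "\<not> (b \<in> e \<and> d \<in> e)" "\<not> (a \<in> e \<and> d \<in> e)"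
      using nonadj far_ends(1) e by (auto simp: adj_def)
    moreover have e2: "e \<subseteq> {a, b, c, d}" "2 \<le> card e"
      using H e verts by (auto simp: hypergraph_def)
    moreover have "\<not> e \<subseteq> {w}" for w
      using e2(2) card_mono[of "{w}" e] by auto
    ultimately show ?thesis by blast
  qed
  have "edges H = {{a, b}, {b, c}, {c, d}}"
    using edge walk dis unfolding adj_def by fastforce
  moreover have "total_distance H = 10"
    using total far two by auto
  ultimately show thesis
    using that dis verts by blast
qed

text \<open>For \<open>m < 4\<close> vertices even a path is too short: distances are below \<open>m\<close>, and for \<open>m = 3\<close> they cannot
all be 2. Since \<open>Suc m choose 2\<close> bounds from below the total distance before the deletion, this
excludes orders below 5.\<close>

lemma total_distance_below_4:
  assumes K: "hypergraph K" and fin: "total_distance K \<noteq> \<infinity>"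
    and ord: "0 < hg_order K" "hg_order K < 4"
  shows "total_distance K < enat (Suc (hg_order K) choose 2)"
proof -
  note dist = distance_less_orderD[OF K fin]
  have "hg_order K = 1 \<or> hg_order K = 2 \<or> hg_order K = 3"
    using ord by linarith
  then consider "hg_order K = 1" | "hg_order K = 2" | "hg_order K = 3" by blast
  then show ?thesis
  proof cases
    case 1
    then obtain a where "verts K = {a}"
      unfolding hg_order_def by (auto simp: card_Suc_eq)
    then have none: "{P. P \<subseteq> verts K \<and> card P = 2} = {}"
      by (auto simp: card_2_iff)
    show ?thesis
      unfolding total_distance_def none using 1 by (simp add: zero_enat_def numeral_2_eq_2)
  next
    case 2
    then obtain a b where V: "verts K = {a, b}" "a \<noteq> b"
      unfolding hg_order_def by (auto simp: card_2_iff)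
    then have one: "{P. P \<subseteq> verts K \<and> card P = 2} = {{a, b}}"
      by (auto simp: card_2_iff)
    obtain k where "distance K a b = enat k" "k < 2"
      using dist[of a b] V 2 by auto
    then show ?thesis
      unfolding total_distance_def one using 2 by (simp add: pair_distance_eq numeral_2_eq_2)
  next
    case 3
    then obtain a b c where V: "verts K = {a, b, c}" "a \<noteq> b" "b \<noteq> c" "a \<noteq> c"
      unfolding hg_order_def by (auto simp: card_3_iff)
    then have three: "{P. P \<subseteq> verts K \<and> card P = 2} = {{a, b}, {b, c}, {a, c}}"
      by (auto simp: card_2_iff)
    have total: "total_distance K = distance K a b + distance K b c + distance K a c"
      unfolding total_distance_def three
      using V by (simp add: pair_distance_eq doubleton_eq_iff add.assoc)
    obtain i where i: "distance K a b = enat i" "i < 3"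
      using dist[of a b] V 3 by auto
    obtain j where j: "distance K b c = enat j" "j < 3"
      using dist[of b c] V 3 by auto
    obtain k where k: "distance K a c = enat k" "k < 3"
      using dist[of a c] V 3 by auto
    have "\<not> (i = 2 \<and> j = 2 \<and> k = 2)"
    proof
      assume all: "i = 2 \<and> j = 2 \<and> k = 2"
      then have "\<not> adj K a b" "\<not> adj K b c" "\<not> adj K a c"
        using i j k distance_le_1_iff[OF K, of a b] distance_le_1_iff[OF K, of b c]
          distance_le_1_iff[OF K, of a c] V by (auto simp: one_enat_def)
      moreover have "distance K a b \<le> 2"
        using i all by (simp add: numeral_eq_enat)
      ultimately obtain w where w: "adj K a w" "adj K w b"
        using distance_le_2_iff[OF K, of a b] V by auto
      then have "w \<in> {a, b, c}" using adj_verts[OF K] V(1) by blast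
      then show False
        using w \<open>\<not> adj K a b\<close> \<open>\<not> adj K a c\<close> by auto
    qed
    then have "i + j + k < 6" using i j k by linarith
    moreover have "Suc (hg_order K) choose 2 = 6"
      using 3 by (simp add: choose_two)
    ultimately show ?thesis
      using total i j k by simp
  qed
qed

lemma soltes_order_ge_5:
  assumes S: "soltes H"
  shows "5 \<le> hg_order H"
proof (rule ccontr)
  assume small: "\<not> ?thesis"
  have H: "hypergraph H" and "2 \<le> hg_order H" using S by (auto simp: soltes_def)
  then obtain v where v: "v \<in> verts H"
    by (fastforce simp: hg_order_def)
  have "total_distance (del_vert H v) < enat (Suc (hg_order (del_vert H v)) choose 2)"
    using S v small \<open>2 \<le> hg_order H\<close>
    by (intro total_distance_below_4 hypergraph_del_vert H) (auto simp: hg_order_del_vert[OF H v] soltes_def)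
  also have "\<dots> \<le> total_distance H"
    using total_distance_ge(1)[OF H] \<open>2 \<le> hg_order H\<close> by (simp add: hg_order_del_vert[OF H v])
  also have "\<dots> = total_distance (del_vert H v)"
    using S v by (simp add: soltes_def)
  finally show False by simp
qed

section \<open>The structure at order five\<close>

text \<open>At order 5 the lower bound before and the upper bound after a deletion are both 10, so each
vertex-deleted hypergraph is a path on four vertices, with three edges of size 2. An edge other
than the full vertex set misses some vertex and hence has size 2. The full vertex set must be an
edge because two non-neighbours on such a path have distance 1 in the whole hypergraph.
If deleting \<open>v\<close> leaves the path \<open>a, b, c, d\<close>, then counting the three edges left by
deleting \<open>a\<close>, \<open>b\<close> or \<open>d\<close> shows that the neighbours of \<open>v\<close> by edges of size 2 are
exactly \<open>a\<close> and \<open>d\<close>, which closes the path to a pentagon.\<close>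

lemma soltes_order_5_structure:
  assumes S: "soltes G" and order: "hg_order G = 5"
  obtains a b c d v where "distinct [a, b, c, d, v]" "verts G = {a, b, c, d, v}"
    "edges G = {{a, b}, {b, c}, {c, d}, {d, v}, {v, a}, {a, b, c, d, v}}"
proof -
  have G: "hypergraph G" using S by (simp add: soltes_def)
  have ge: "10 \<le> total_distance G"
    using total_distance_ge(1)[OF G] order by (simp add: choose_two numeral_eq_enat)
  have del: "\<exists>a b c d. distinct [a, b, c, d] \<and> verts G - {w} = {a, b, c, d} \<and>
      {e \<in> edges G. w \<notin> e} = {{a, b}, {b, c}, {c, d}} \<and> total_distance G = 10"
    if w: "w \<in> verts G" for w
  proof -
    have "total_distance (del_vert G w) \<noteq> \<infinity>" "10 \<le> total_distance (del_vert G w)"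
      "total_distance G = total_distance (del_vert G w)"
      using S w ge by (auto simp: soltes_def)
    moreover have "hg_order (del_vert G w) = 4"
      using hg_order_del_vert[OF G w] order by simp
    ultimately obtain a b c d where "distinct [a, b, c, d]" "verts (del_vert G w) = {a, b, c, d}"
      "edges (del_vert G w) = {{a, b}, {b, c}, {c, d}}" "total_distance (del_vert G w) = 10"
      using farthest_on_4_is_path[OF hypergraph_del_vert[OF G]] by metis
    then show ?thesis
      using \<open>total_distance G = total_distance (del_vert G w)\<close> unfolding del_vert_def
      by (intro exI[of _ a] exI[of _ b] exI[of _ c] exI[of _ d]) simp
  qed
  obtain v where v: "v \<in> verts G"
    using order by (fastforce simp: hg_order_def)
  obtain a b c d where dis4: "distinct [a, b, c, d]" and V4: "verts G - {v} = {a, b, c, d}"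
    and path: "{e \<in> edges G. v \<notin> e} = {{a, b}, {b, c}, {c, d}}" and total: "total_distance G = 10"
    using del[OF v] by (elim exE conjE) (rule that)
  have V: "verts G = {a, b, c, d, v}" using v V4 by blast
  have dis: "distinct [a, b, c, d, v]" using dis4 V4 by auto
  have missing: "card e = 2" if e: "e \<in> edges G" "w \<notin> e" and w: "w \<in> verts G" for e w
  proof -
    obtain p q r s where pqrs: "distinct [p, q, r, s]" "verts G - {w} = {p, q, r, s}"
      "{e \<in> edges G. w \<notin> e} = {{p, q}, {q, r}, {r, s}}" "total_distance G = 10"
      using del[OF w] by (elim exE conjE) (rule that)
    have "e \<in> {{p, q}, {q, r}, {r, s}}"
      unfolding pqrs(3)[symmetric] using e by simp
    then show ?thesis using pqrs(1) by (elim insertE emptyE) simp_all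
  qed
  have avoid: "card {e \<in> edges G. w \<notin> e} = 3" if w: "w \<in> verts G" for w
  proof -
    obtain p q r s where pqrs: "distinct [p, q, r, s]" "verts G - {w} = {p, q, r, s}"
      "{e \<in> edges G. w \<notin> e} = {{p, q}, {q, r}, {r, s}}" "total_distance G = 10"
      using del[OF w] by (elim exE conjE) (rule that)
    show ?thesis
      unfolding pqrs(3) using pqrs(1) by (simp add: doubleton_eq_iff)
  qed
  have "distance G a c \<le> 1"
    using total_distance_ge(2)[OF G] total order V by (simp add: choose_two numeral_eq_enat)
  then obtain f where f: "f \<in> edges G" "a \<in> f" "c \<in> f"
    using distance_le_1_iff[OF G, of a c] V dis by (auto simp: adj_def)
  have full: "{a, b, c, d, v} \<in> edges G"
  proof -
    have "v \<in> f"
    proof (rule ccontr)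
      assume "v \<notin> f"
      then have "f \<in> {{a, b}, {b, c}, {c, d}}"
        using f(1) path[symmetric] by simp
      then show False using f(2,3) dis by auto
    qed
    then have "{a, c, v} \<subseteq> f" using f by simp
    moreover have "finite f"
      using G f by (auto simp: hypergraph_def intro: finite_subset)
    ultimately have "card {a, c, v} \<le> card f" by (rule card_mono[rotated])
    then have "card f \<noteq> 2" using dis by simp
    then have "verts G \<subseteq> f" using missing f(1) by blast
    moreover have "f \<subseteq> verts G" using G f(1) by (simp add: hypergraph_def)
    ultimately have "f = verts G" by simp
    then show ?thesis using f(1) V by simp
  qed
  have edge: "e = {a, b, c, d, v} \<or> e \<in> {{a, b}, {b, c}, {c, d}} \<or> e \<in> {{a, v}, {b, v}, {c, v}, {d, v}}"
    if e: "e \<in> edges G" for e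
  proof (cases "verts G \<subseteq> e")
    case True
    then have "e = verts G" using G e by (simp add: hypergraph_def subset_antisym)
    then show ?thesis using V by simp
  next
    case False
    have "card e = 2" using False missing[OF e] by blast
    have "e \<subseteq> verts G" using G e by (simp add: hypergraph_def)
    show ?thesis
    proof (cases "v \<in> e")
      case True
      obtain x y where "e = {x, y}" "x \<noteq> y"
        using \<open>card e = 2\<close> unfolding card_2_iff by blast
      with True obtain w where w: "e = {w, v}" "w \<noteq> v" by blast
      then have "w \<in> {a, b, c, d}" using \<open>e \<subseteq> verts G\<close> V by simp
      then show ?thesis using w(1) by (elim insertE emptyE) simp_all
    next
      case False
      then have "e \<in> {{a, b}, {b, c}, {c, d}}"
        unfolding path[symmetric] using e by simp
      then show ?thesis by simp
    qed
  qed
  have old: "{{a, b}, {b, c}, {c, d}} \<subseteq> edges G" using path by blast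
  define N where "N X = {w \<in> X. {w, v} \<in> edges G}" for X
  \<comment> \<open>Three edges avoid \<open>w\<close>: those among them on the path form \<open>S\<close>, the others join \<open>v\<close> to \<open>N X\<close>.\<close>
  have degree: "card (N X) + card S = 3"
    if w: "w \<in> {a, b, c, d}" and X: "X = {a, b, c, d} - {w}"
      and S: "S \<subseteq> {{a, b}, {b, c}, {c, d}}"
        "\<forall>e\<in>{{a, b}, {b, c}, {c, d}}. e \<in> S \<longleftrightarrow> w \<notin> e" for w X S
  proof -
    let ?E = "(\<lambda>x. {x, v}) ` N X"
    have "w \<noteq> v" using w dis by auto
    have "{e \<in> edges G. w \<notin> e} = ?E \<union> S"
    proof (intro equalityI subsetI)
      fix e assume "e \<in> {e \<in> edges G. w \<notin> e}"
      then have e: "e \<in> edges G" "w \<notin> e" by simp_all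
      then consider "e \<in> {{a, b}, {b, c}, {c, d}}" | "e \<in> (\<lambda>x. {x, v}) ` {a, b, c, d}"
        using edge[OF e(1)] w by auto
      then show "e \<in> ?E \<union> S"
      proof cases
        case 1 then show ?thesis using bspec[OF S(2) 1] e(2) by simp
      next
        case 2 then show ?thesis using e by (auto simp: X N_def)
      qed
    next
      fix e assume "e \<in> ?E \<union> S"
      then show "e \<in> {e \<in> edges G. w \<notin> e}"
      proof
        assume "e \<in> ?E"
        then show ?thesis using \<open>w \<noteq> v\<close> by (auto simp: X N_def)
      next
        assume "e \<in> S"
        then have mem: "e \<in> {{a, b}, {b, c}, {c, d}}" using S(1) by (rule rev_subsetD)
        then have "w \<notin> e" using bspec[OF S(2) mem] \<open>e \<in> S\<close> by simp
        then show ?thesis using subsetD[OF old mem] by simp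
      qed
    qed
    moreover have "finite ?E" "finite S" using finite_subset[OF S(1)] by (simp_all add: N_def X)
    moreover have "?E \<inter> S = {}"
    proof -
      have "v \<notin> \<Union>{{a, b}, {b, c}, {c, d}}" using dis by auto
      then show ?thesis using S(1) by blast
    qed
    moreover have "card ?E = card (N X)"
      by (intro card_image inj_onI) (auto simp: doubleton_eq_iff)
    ultimately have "card {e \<in> edges G. w \<notin> e} = card (N X) + card S"
      by (simp add: card_Un_disjoint)
    moreover have "w \<in> verts G" using w V by auto
    ultimately show ?thesis using avoid by simp
  qed
  have ne: "a \<noteq> b" "a \<noteq> c" "a \<noteq> d" "a \<noteq> v" "b \<noteq> c" "b \<noteq> d" "b \<noteq> v" "c \<noteq> d" "c \<noteq> v" "d \<noteq> v"
    using dis by simp_all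
  note ne = ne ne[symmetric]
  have from_a: "card (N {b, c, d}) = 1"
    using degree[of a "{b, c, d}" "{{b, c}, {c, d}}"] by (simp add: ne doubleton_eq_iff insert_Diff_if)
  have from_d: "card (N {a, b, c}) = 1"
    using degree[of d "{a, b, c}" "{{a, b}, {b, c}}"] by (simp add: ne doubleton_eq_iff insert_Diff_if)
  have from_b: "card (N {a, c, d}) = 2"
    using degree[of b "{a, c, d}" "{{c, d}}"] by (simp add: ne doubleton_eq_iff insert_Diff_if)
  have sets: "{w \<in> insert x X. P w} = (if P x then insert x {w \<in> X. P w} else {w \<in> X. P w})"
    for x X and P :: "'a \<Rightarrow> bool"
    by auto
  have nbrs: "{a, v} \<in> edges G" "{d, v} \<in> edges G" "{b, v} \<notin> edges G" "{c, v} \<notin> edges G"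
    using from_a from_b from_d unfolding N_def sets by (simp_all add: ne split: if_splits)
  have "edges G = {{a, b}, {b, c}, {c, d}, {d, v}, {v, a}, {a, b, c, d, v}}"
  proof (intro equalityI subsetI)
    fix e assume e: "e \<in> edges G"
    then have "e \<noteq> {b, v}" "e \<noteq> {c, v}" using nbrs(3,4) by blast+
    then show "e \<in> {{a, b}, {b, c}, {c, d}, {d, v}, {v, a}, {a, b, c, d, v}}"
      using edge[OF e] unfolding insert_commute[of v a] by (elim disjE insertE emptyE) simp_all
  next
    fix e assume "e \<in> {{a, b}, {b, c}, {c, d}, {d, v}, {v, a}, {a, b, c, d, v}}"
    then show "e \<in> edges G"
      using old full nbrs(1,2) unfolding insert_commute[of v a]
      by (elim insertE emptyE) simp_all
  qed
  then show thesis
    by (rule that[OF dis V])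
qed

section \<open>Examples of orders five, six and seven\<close>

text \<open>Small hypergraphs are given by lists of edges, so that the excess can be found by evaluation. The
full edge is left out of the list since it disappears in every deletion.\<close>

definition full_with :: "nat \<Rightarrow> nat list list \<Rightarrow> nat hypergraph" where
  "full_with n es = \<lparr>verts = {..<n}, edges = insert {..<n} (set ` set es)\<rparr>"

definition linked :: "nat list list \<Rightarrow> nat \<Rightarrow> nat \<Rightarrow> nat \<Rightarrow> bool" where
  "linked es v x y \<longleftrightarrow> (\<exists>e\<in>set es. v \<notin> set e \<and> x \<in> set e \<and> y \<in> set e)"

definition pair_list :: "nat \<Rightarrow> nat \<Rightarrow> (nat \<times> nat) list" where
  "pair_list n v = [(x, y) \<leftarrow> List.product [0..<n] [0..<n]. x \<noteq> v \<and> y \<noteq> v \<and> x < y]"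

text \<open>The lists collect the pairs at distance more than 1, 2 and 3 after deleting \<open>v\<close>. Each filters the
preceding one, so the test for distance \<open>k\<close> only looks for walks of length exactly \<open>k\<close>.\<close>

definition excess_ok :: "nat \<Rightarrow> nat list list \<Rightarrow> nat \<Rightarrow> bool" where
  "excess_ok n es v \<longleftrightarrow>
    (let far1 = [(x, y) \<leftarrow> pair_list n v. \<not> linked es v x y];
         far2 = [(x, y) \<leftarrow> far1. \<not> (\<exists>w\<in>set [0..<n]. linked es v x w \<and> linked es v w y)];
         far3 = [(x, y) \<leftarrow> far2. \<not> (\<exists>w\<in>set [0..<n]. linked es v x w \<and>
           (\<exists>z\<in>set [0..<n]. linked es v w z \<and> linked es v z y))]
     in far3 = [] \<and> length far1 + length far2 = n - 1)"

definition proper_lists :: "nat \<Rightarrow> nat list list \<Rightarrow> bool" where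
  "proper_lists n es \<longleftrightarrow> (\<forall>e\<in>set es. 2 \<le> length e \<and> distinct e \<and> (\<forall>x\<in>set e. x < n))"

lemma soltes_full_with:
  assumes n: "2 \<le> n" and proper: "proper_lists n es" and ok: "\<forall>v\<in>set [0..<n]. excess_ok n es v"
  shows "soltes (full_with n es)"
proof (rule soltes_if_excess)
  let ?H = "full_with n es"
  show H: "hypergraph ?H"
    using proper n by (auto simp: hypergraph_def full_with_def proper_lists_def distinct_card)
  show "2 \<le> hg_order ?H" "verts ?H \<in> edges ?H"
    using n by (simp_all add: full_with_def hg_order_def)
  fix v assume "v \<in> verts ?H"
  then have v: "v < n" by (simp add: full_with_def)
  let ?D = "del_vert ?H v"
  note D = hypergraph_del_vert[OF H, of v]
  have adj: "adj ?D x y \<longleftrightarrow> linked es v x y" for x y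
    using v by (auto simp: adj_def del_vert_def full_with_def linked_def)
  have lt: "linked es v x y \<Longrightarrow> x < n \<and> y < n" for x y
    using proper by (auto simp: linked_def proper_lists_def)
  have pairs: "(x, y) \<in> pairs (verts ?H - {v}) \<longleftrightarrow> (x, y) \<in> set (pair_list n v)" for x y
    by (auto simp: pairs_def pair_list_def full_with_def)
  have mem: "x \<in> verts ?D" "x \<noteq> y" if "(x, y) \<in> set (pair_list n v)" for x y
    using that by (auto simp: full_with_def pair_list_def)
  define far1 where "far1 = [(x, y) \<leftarrow> pair_list n v. \<not> linked es v x y]"
  define far2 where "far2 = [(x, y) \<leftarrow> far1. \<not> (\<exists>w\<in>set [0..<n]. linked es v x w \<and> linked es v w y)]"
  define far3 where "far3 = [(x, y) \<leftarrow> far2. \<not> (\<exists>w\<in>set [0..<n]. linked es v x w \<and>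
           (\<exists>z\<in>set [0..<n]. linked es v w z \<and> linked es v z y))]"
  have ok': "far3 = []" "length far1 + length far2 = n - 1"
    using ok v by (auto simp: excess_ok_def far1_def far2_def far3_def Let_def)
  have far1: "set far1 = {(x, y) \<in> pairs (verts ?H - {v}). \<not> distance ?D x y \<le> 1}"
    using distance_le_1_iff[OF D] mem by (auto simp: far1_def pairs adj)
  have far2: "set far2 = {(x, y) \<in> pairs (verts ?H - {v}). \<not> distance ?D x y \<le> 2}"
    using distance_le_2_iff[OF D] mem lt by (auto simp: far2_def far1_def pairs adj) 
  have "distinct far1" "distinct far2"
    by (simp_all add: far1_def far2_def pair_list_def distinct_product)
  then show "card {(x, y) \<in> pairs (verts ?H - {v}). \<not> distance ?D x y \<le> 1} +
      card {(x, y) \<in> pairs (verts ?H - {v}). \<not> distance ?D x y \<le> 2} = hg_order ?H - 1"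
    using ok'(2) unfolding far1[symmetric] far2[symmetric]
    by (simp add: distinct_card full_with_def hg_order_def)
  fix x y assume xy: "(x, y) \<in> pairs (verts ?H - {v})"
  then have "x \<in> verts ?D" using pairs mem by blast
  have "(x, y) \<notin> set far3" using ok' by simp
  then show "distance ?D x y \<le> 3"
    using xy lt unfolding distance_le_3_iff[OF D \<open>x \<in> verts ?D\<close>] adj far3_def far2_def far1_def pairs
    by auto
qed

definition pentagon :: "nat hypergraph" where
  "pentagon = full_with 5 [[0, 1], [1, 2], [2, 3], [3, 4], [4, 0]]"

text \<open>Every vertex-deleted subhypergraph is a path on four vertices, with three pairs at distance more than
1 and one at distance more than 2.\<close>

lemma soltes_pentagon: "soltes pentagon"
  unfolding pentagon_def by (rule soltes_full_with; code_simp)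

text \<open>Two disjoint triangles, each with one apex (0 and 5) joined to the two other vertices of the
other triangle. These and the triples for order 7 are sporadic: orders 6 and 7 are too small for
the cyclic construction below.\<close>

lemma soltes_order_6: "\<exists>H :: nat hypergraph. soltes H \<and> hg_order H = 6"
proof (intro exI conjI)
  let ?H = "full_with 6 [[0, 1, 2], [3, 4, 5], [0, 3], [0, 4], [5, 1], [5, 2]]"
  show "soltes ?H"
    by (rule soltes_full_with; code_simp)
  show "hg_order ?H = 6"
    by (simp add: full_with_def hg_order_def)
qed

text \<open>With \<open>j\<close> the successor of \<open>i\<close> in the cycle \<open>0, 1, 2\<close>, the triples are \<open>{i, j, 6}\<close> and
\<open>{i, i + 3, j + 3}\<close>.\<close>

lemma soltes_order_7: "\<exists>H :: nat hypergraph. soltes H \<and> hg_order H = 7"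
proof (intro exI conjI)
  let ?H = "full_with 7 [[0, 1, 6], [1, 2, 6], [2, 0, 6], [0, 3, 4], [1, 4, 5], [2, 5, 3]]"
  show "soltes ?H"
    by (rule soltes_full_with; code_simp)
  show "hg_order ?H = 7"
    by (simp add: full_with_def hg_order_def)
qed

lemma pentagon_order: "hg_order pentagon = 5"
  by (simp add: pentagon_def full_with_def hg_order_def)

lemma soltes_order_5_isomorphic:
  assumes "soltes G" "hg_order G = 5"
  shows "isomorphic G pentagon"
proof -
  obtain a b c d v where dis: "distinct [a, b, c, d, v]" and V: "verts G = {a, b, c, d, v}"
    and E: "edges G = {{a, b}, {b, c}, {c, d}, {d, v}, {v, a}, {a, b, c, d, v}}"
    using soltes_order_5_structure[OF assms] .
  define f where "f = (\<lambda>_. 4 :: nat)(a := 0, b := 1, c := 2, d := 3)"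
  have f: "f a = 0" "f b = 1" "f c = 2" "f d = 3" "f v = 4"
    using dis by (auto simp: f_def)
  have five: "{..<5} = {0, 1, 2, 3, 4 :: nat}" by auto
  have "bij_betw f (verts G) (verts pentagon)"
    using dis by (simp add: bij_betw_def V f pentagon_def full_with_def five)
  moreover have "edges pentagon = image f ` edges G"
    by (simp add: E f pentagon_def full_with_def five insert_commute)
  ultimately show ?thesis
    unfolding isomorphic_def by blast
qed

section \<open>Cyclic examples of order at least eight\<close>

lemma walk_image:
  assumes f: "\<And>x y. adj G x y \<Longrightarrow> adj H (f x) (f y)" and walk: "(adj G ^^ k) u v"
  shows "(adj H ^^ k) (f u) (f v)"
  using walk
proof (induction k arbitrary: v)
  case 0 then show ?case by simp
next
  case (Suc k) then show ?case using f by (auto intro: relcomppI)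
qed

lemma distance_image_le:
  assumes G: "hypergraph G" and H: "hypergraph H" and u: "u \<in> verts G" "f u \<in> verts H"
    and f: "\<And>x y. adj G x y \<Longrightarrow> adj H (f x) (f y)"
  shows "distance H (f u) (f v) \<le> distance G u v"
proof (cases "distance G u v")
  case (enat k)
  then obtain j where "j \<le> k" "(adj G ^^ j) u v"
    using distance_le_iff[OF G u(1), of v k] by auto
  then show ?thesis
    using walk_image[where f = f, OF f] enat distance_le_iff[OF H u(2), of "f v" k] by auto
qed simp

lemma total_distance_isomorphic:
  assumes G: "hypergraph G" and H: "hypergraph H" and iso: "isomorphic G H"
  shows "total_distance G = total_distance H"
proof -
  obtain f where f: "bij_betw f (verts G) (verts H)" and E: "edges H = image f ` edges G"
    using iso unfolding isomorphic_def by blast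
  define g where "g = inv_into (verts G) f"
  have g: "bij_betw g (verts H) (verts G)" "\<And>x. x \<in> verts G \<Longrightarrow> g (f x) = x"
    using f bij_betw_inv_into[OF f] by (simp_all add: g_def bij_betw_inv_into_left)
  have f_adj: "adj H (f x) (f y)" if "adj G x y" for x y
    using that by (auto simp: adj_def E)
  have g_adj: "adj G (g x) (g y)" if xy: "adj H x y" for x y
  proof -
    obtain e' where e': "e' \<in> edges H" "x \<in> e'" "y \<in> e'"
      using xy unfolding adj_def by blast
    then obtain e where e: "e \<in> edges G" "e' = f ` e"
      unfolding E by blast
    moreover have "e \<subseteq> verts G" using e G by (auto simp: hypergraph_def)
    ultimately show ?thesis using e' g(2) unfolding adj_def by (intro bexI[of _ e]) auto
  qed
  have dist: "distance H (f u) (f v) = distance G u v" if "u \<in> verts G" "v \<in> verts G" for u v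
  proof (rule antisym)
    show "distance H (f u) (f v) \<le> distance G u v"
      using that f by (intro distance_image_le G H f_adj) (auto simp: bij_betw_def)
    have "distance G (g (f u)) (g (f v)) \<le> distance H (f u) (f v)"
      using that f g by (intro distance_image_le G H g_adj) (auto simp: bij_betw_def)
    then show "distance G u v \<le> distance H (f u) (f v)" using that g by simp
  qed
  have "bij_betw (image f) {P. P \<subseteq> verts G \<and> card P = 2} {P. P \<subseteq> verts H \<and> card P = 2}"
  proof -
    have "card (f ` P) = 2 \<longleftrightarrow> card P = 2" if "P \<in> Pow (verts G)" for P
      using that f by (auto simp: bij_betw_def card_image dest: inj_on_subset)
    then have "bij_betw (image f) {P \<in> Pow (verts G). card P = 2} {P \<in> Pow (verts H). card P = 2}"
      by (intro bij_betw_Collect bij_betw_Pow f)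
    then show ?thesis by (simp only: Pow_iff)
  qed
  then have "total_distance H = (\<Sum>P | P \<subseteq> verts G \<and> card P = 2. pair_distance H (f ` P))"
    unfolding total_distance_def by (rule sum.reindex_bij_betw[symmetric])
  also have "\<dots> = total_distance G"
    unfolding total_distance_def
  proof (rule sum.cong[OF refl])
    fix P assume "P \<in> {P. P \<subseteq> verts G \<and> card P = 2}"
    then obtain u v where "P = {u, v}" "u \<in> verts G" "v \<in> verts G"
      by (auto simp: card_2_iff)
    then show "pair_distance H (f ` P) = pair_distance G P"
      by (simp add: pair_distance_eq dist)
  qed
  finally show ?thesis by simp
qed

text \<open>A vertex permutation that maps edges to edges is an automorphism because there are only finitely
many edges. It identifies the deletion of a vertex with the deletion of its image, so a
vertex-transitive hypergraph has to be inspected at one vertex only.\<close>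

lemma del_vert_automorphism:
  assumes H: "hypergraph H" and f: "bij_betw f (verts H) (verts H)"
    and edges: "\<And>e. e \<in> edges H \<Longrightarrow> f ` e \<in> edges H" and v: "v \<in> verts H"
  shows "isomorphic (del_vert H v) (del_vert H (f v))"
proof -
  have inj: "inj_on f (verts H)" and sub: "edges H \<subseteq> Pow (verts H)"
    using f H by (auto simp: bij_betw_def hypergraph_def)
  have "finite (edges H)"
    using sub H by (auto simp: hypergraph_def intro: finite_subset)
  moreover have "inj_on (image f) (edges H)"
  proof (rule inj_onI)
    fix e e' assume "e \<in> edges H" "e' \<in> edges H" "f ` e = f ` e'"
    then show "e = e'"
      using inj_on_image_eq_iff[OF inj, of e e'] sub by auto
  qed
  ultimately have img: "image f ` edges H = edges H"
    using edges by (intro endo_inj_surj) auto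
  have mem: "f v \<in> f ` e \<longleftrightarrow> v \<in> e" if "e \<in> edges H" for e
    using inj sub that v by (intro inj_on_image_mem_iff[where B = "verts H"]) auto
  have "{e \<in> edges H. f v \<notin> e} = image f ` {e \<in> edges H. v \<notin> e}"
  proof (intro equalityI subsetI)
    fix e' assume e': "e' \<in> {e \<in> edges H. f v \<notin> e}"
    then obtain e where "e \<in> edges H" "e' = f ` e" using img by blast
    then show "e' \<in> image f ` {e \<in> edges H. v \<notin> e}" using e' by auto
  next
    fix e' assume "e' \<in> image f ` {e \<in> edges H. v \<notin> e}"
    then show "e' \<in> {e \<in> edges H. f v \<notin> e}" using edges mem by auto
  qed
  moreover have "bij_betw f (verts H - {v}) (verts H - {f v})"
    using f v by (auto simp: bij_betw_def inj_on_diff inj_on_image_set_diff dest: inj_onD)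
  ultimately show ?thesis
    unfolding isomorphic_def del_vert_def by (intro exI[of _ f]) simp
qed

definition succ_mod :: "nat \<Rightarrow> nat \<Rightarrow> nat" where
  "succ_mod n x = (if Suc x = n then 0 else Suc x)"

text \<open>Call the length of the shorter arc between two points of the cycle of length \<open>n\<close> their cyclic
distance, and disregard the full edge, which no deletion leaves. Pairs at cyclic distance 4 or more are edges of size 2, and no deletion of a third vertex
separates them. Pairs at cyclic distance 1 or 2 are covered by triples of consecutive points.
A pair at cyclic distance 1 lies in two triples, and deleting a vertex destroys at most one
of them; a pair at cyclic distance 2 lies only in the triple with its midpoint, so the deletion of
\<open>v\<close> separates exactly the two neighbours of \<open>v\<close>. Pairs at cyclic distance 3 are not covered, and
\<open>n - 2\<close> of these avoid \<open>v\<close>. Together this makes \<open>n - 1\<close> pairs at distance more than 1. Cyclic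
distance 3 must differ from \<open>n / 2\<close> for this count, and for \<open>n = 7\<close> the two neighbours of the
deleted vertex would be at distance 3, whence the bound 8.\<close>

definition circulant_edges :: "nat \<Rightarrow> nat set set" where
  "circulant_edges n = insert {..<n}
    ({{x, y} | x y. x < y \<and> y < n \<and> 4 \<le> y - x \<and> y - x \<le> n - 4} \<union>
     {{x, succ_mod n x, succ_mod n (succ_mod n x)} | x. x < n})"

definition circulant :: "nat \<Rightarrow> nat hypergraph" where
  "circulant n = \<lparr>verts = {..<n}, edges = circulant_edges n\<rparr>"

lemma succ_mod_bij:
  assumes "0 < n"
  shows "bij_betw (succ_mod n) {..<n} {..<n}"
proof -
  have "inj_on (succ_mod n) {..<n}" by (auto simp: inj_on_def succ_mod_def split: if_splits)
  moreover have "succ_mod n ` {..<n} \<subseteq> {..<n}" using assms by (auto simp: succ_mod_def)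
  ultimately show ?thesis
    by (simp add: bij_betw_def endo_inj_surj)
qed

lemma hypergraph_circulant:
  assumes n: "8 \<le> n"
  shows "hypergraph (circulant n)"
proof -
  have "e \<subseteq> {..<n} \<and> 2 \<le> card e" if e: "e \<in> circulant_edges n" for e
  proof -
    consider "e = {..<n}" | x y where "e = {x, y}" "x < y" "y < n"
      | x where "e = {x, succ_mod n x, succ_mod n (succ_mod n x)}" "x < n"
      using e unfolding circulant_edges_def by blast
    then show ?thesis
    proof cases
      case 1 then show ?thesis using n by simp
    next
      case 2 then show ?thesis by auto
    next
      case 3
      have "{x, succ_mod n x} \<subseteq> e" "finite e" using 3 by auto
      then have "card {x, succ_mod n x} \<le> card e" by (intro card_mono)
      then show ?thesis using 3 n by (auto simp: succ_mod_def split: if_splits)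
    qed
  qed
  then show ?thesis by (simp add: hypergraph_def circulant_def)
qed

lemma succ_mod_circulant_edges:
  assumes n: "8 \<le> n" and e: "e \<in> circulant_edges n"
  shows "succ_mod n ` e \<in> circulant_edges n"
proof -
  consider "e = {..<n}" | x y where "e = {x, y}" "x < y" "y < n" "4 \<le> y - x" "y - x \<le> n - 4"
    | x where "e = {x, succ_mod n x, succ_mod n (succ_mod n x)}" "x < n"
    using e unfolding circulant_edges_def by blast
  then show ?thesis
  proof cases
    case 1
    then show ?thesis using succ_mod_bij[of n] n by (simp add: bij_betw_def circulant_edges_def)
  next
    case 2
    show ?thesis
    proof (cases "Suc y = n")
      case True
      then have "succ_mod n ` e = {0, Suc x}" "0 < Suc x" "Suc x < n" "4 \<le> Suc x - 0" "Suc x - 0 \<le> n - 4"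
        using 2 by (auto simp: succ_mod_def)
      then show ?thesis unfolding circulant_edges_def by blast
    next
      case False
      then have "succ_mod n ` e = {Suc x, Suc y}" "Suc x < Suc y" "Suc y < n"
        "4 \<le> Suc y - Suc x" "Suc y - Suc x \<le> n - 4"
        using 2 by (auto simp: succ_mod_def)
      then show ?thesis unfolding circulant_edges_def by blast
    qed
  next
    case 3
    then have "succ_mod n x < n" by (auto simp: succ_mod_def)
    then show ?thesis using 3 unfolding circulant_edges_def by auto
  qed
qed

lemma adj_circulant_del_0:
  assumes n: "8 \<le> n" and xy: "0 < x" "x < y" "y < n"
  shows "adj (del_vert (circulant n) 0) x y \<longleftrightarrow> y - x \<notin> {3, n - 3, n - 2}"
proof
  assume "adj (del_vert (circulant n) 0) x y"
  then obtain e where e: "e \<in> circulant_edges n" "0 \<notin> e" "x \<in> e" "y \<in> e"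
    by (auto simp: adj_def del_vert_def circulant_def)
  then consider "e = {..<n}" | a b where "e = {a, b}" "a < b" "b < n" "4 \<le> b - a" "b - a \<le> n - 4"
    | a where "e = {a, succ_mod n a, succ_mod n (succ_mod n a)}" "a < n"
    unfolding circulant_edges_def by blast
  then show "y - x \<notin> {3, n - 3, n - 2}"
  proof cases
    case 1 then show ?thesis using e n by auto
  next
    case 2
    then have "x = a" "y = b" using e xy by auto
    then show ?thesis using 2 n by auto
  next
    case 3
    then have "e = {a, Suc a, Suc (Suc a)}" using e by (auto simp: succ_mod_def split: if_splits)
    then have "y - x \<le> 2" using e(3,4) by auto
    then show ?thesis using n by auto
  qed
next
  assume diff: "y - x \<notin> {3, n - 3, n - 2}"
  have adjI: "adj (del_vert (circulant n) 0) x y" if "e \<in> circulant_edges n" "0 \<notin> e" "x \<in> e" "y \<in> e" for e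
    using that by (auto simp: adj_def del_vert_def circulant_def)
  show "adj (del_vert (circulant n) 0) x y"
  proof (cases "y - x \<le> 2")
    case True
    \<comment> \<open>The triple starts at \<open>x\<close>, or one step earlier when it would otherwise wrap around to 0.\<close>
    define a where "a = (if Suc (Suc x) < n then x else x - 1)"
    have a: "0 < a" "Suc (Suc a) < n" "x \<in> {a, Suc a, Suc (Suc a)}" "y \<in> {a, Suc a, Suc (Suc a)}"
      using True xy n by (auto simp: a_def)
    then have "{a, Suc a, Suc (Suc a)} = {a, succ_mod n a, succ_mod n (succ_mod n a)}"
      by (simp add: succ_mod_def)
    also have "\<dots> \<in> circulant_edges n"
      using a(2) unfolding circulant_edges_def by (blast dest: Suc_lessD)
    finally have "{a, Suc a, Suc (Suc a)} \<in> circulant_edges n" .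
    then show ?thesis using a by (intro adjI) auto
  next
    case False
    then have "4 \<le> y - x" "y - x \<le> n - 4" using diff xy by auto
    then have "{x, y} \<in> circulant_edges n" using xy unfolding circulant_edges_def by blast
    then show ?thesis using xy by (intro adjI) auto
  qed
qed

text \<open>Without the vertex 0 the cycle becomes the interval from 1 to \<open>n - 1\<close>, and the \<open>n - 1\<close> non-adjacent
pairs can be listed: \<open>n - 4\<close> pairs \<open>(x, x + 3)\<close>, two pairs whose short arc of length 3 runs through 0,
and the pair of the neighbours of 0. Each of these pairs has a common neighbour.\<close>

lemma total_distance_circulant_del_0:
  assumes n: "8 \<le> n"
  shows "total_distance (del_vert (circulant n) 0) = enat (n choose 2)"
proof -
  define D where "D = del_vert (circulant n) 0"
  have D: "hypergraph D" unfolding D_def by (rule hypergraph_del_vert[OF hypergraph_circulant[OF n]])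
  have V: "verts D = {0<..<n}" by (auto simp: D_def circulant_def)
  have adj: "adj D x y \<longleftrightarrow> y - x \<notin> {3, n - 3, n - 2}" if "0 < x" "x < y" "y < n" for x y
    unfolding D_def by (rule adj_circulant_del_0[OF n that])
  have two: "distance D x y \<le> 2" if xy: "x \<in> verts D" "y \<in> verts D" "x < y" for x y
  proof (cases "adj D x y")
    case True then show ?thesis using distance_le_2_iff[OF D xy(1)] by blast
  next
    case False
    have pos: "0 < x" "x < y" "y < n" using xy unfolding V by simp_all
    then have "y = x + 3 \<or> x = 1 \<and> y = n - 2 \<or> x = 2 \<and> y = n - 1 \<or> x = 1 \<and> y = n - 1"
      using False adj[OF pos] n by auto
    then consider "y = x + 3" | "x = 1" "y = n - 2" | "x = 2 \<or> x = 1" "y = n - 1" by blast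
    then have "\<exists>w. adj D x w \<and> adj D w y"
    proof cases
      case 1
      then show ?thesis using adj[of x "Suc x"] adj[of "Suc x" y] pos n by (intro exI[of _ "Suc x"]) auto
    next
      case 2
      then show ?thesis using adj[of x "n - 3"] adj[of "n - 3" y] pos n by (intro exI[of _ "n - 3"]) auto
    next
      case 3
      then show ?thesis using adj[of x 3] adj[of 3 y] pos n by (intro exI[of _ 3]) auto
    qed
    then show ?thesis using distance_le_2_iff[OF D xy(1)] by blast
  qed
  have "{(x, y). (x, y) \<in> pairs (verts D) \<and> \<not> distance D x y \<le> 1} =
      (\<lambda>x. (x, x + 3)) ` {0<..<n - 3} \<union> {(1 :: nat, n - 2), (2, n - 1), (1, n - 1)}" (is "?far = ?N")
  proof -
    have "p \<in> ?far \<longleftrightarrow> p \<in> ?N" for p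
    proof (cases p)
      case (Pair x y)
      show ?thesis
      proof (cases "0 < x \<and> x < y \<and> y < n")
        case True
        then have "p \<in> ?far \<longleftrightarrow> y - x \<in> {3, n - 3, n - 2}"
          using adj[of x y] distance_le_1_iff[OF D, of x y] by (auto simp: Pair pairs_def V)
        also have "\<dots> \<longleftrightarrow> p \<in> ?N"
          using True n by (auto simp: Pair)
        finally show ?thesis .
      next
        case False
        then show ?thesis using n by (auto simp: Pair pairs_def V)
      qed
    qed
    then show ?thesis by blast
  qed
  moreover have "card ?N = n - 1"
  proof -
    have "card ((\<lambda>x. (x, x + 3)) ` {0<..<n - 3}) = n - 4"
      by (subst card_image) (auto simp: inj_on_def)
    moreover have "card {(1 :: nat, n - 2), (2, n - 1), (1, n - 1)} = 3"
      using n by auto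
    moreover have "(\<lambda>x. (x, x + 3)) ` {0<..<n - 3} \<inter> {(1 :: nat, n - 2), (2, n - 1), (1, n - 1)} = {}"
      using n by auto
    ultimately show ?thesis using n by (subst card_Un_disjoint) auto
  qed
  moreover have "card {(x, y). (x, y) \<in> pairs (verts D) \<and> \<not> distance D x y \<le> 2} = card ({} :: (nat \<times> nat) set)"
    using two by (intro arg_cong[where f = card]) (auto simp: pairs_def)
  moreover have "distance D x y \<le> 3" if "x \<in> verts D" "y \<in> verts D" "x < y" for x y
    using two[OF that] by (rule order_trans) simp
  moreover have "hg_order D = n - 1" by (simp add: hg_order_def V)
  moreover have "(n - 1 choose 2) + (n - 1) = n choose 2"
    using n by (cases n) (simp_all add: numeral_2_eq_2)
  ultimately show ?thesis
    using total_distance_within_3[OF D] unfolding D_def[symmetric] by simp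
qed

lemma soltes_circulant:
  assumes n: "8 \<le> n"
  shows "soltes (circulant n)"
proof (rule soltesI)
  let ?H = "circulant n"
  show H: "hypergraph ?H" using hypergraph_circulant[OF n] .
  show "2 \<le> hg_order ?H" "verts ?H \<in> edges ?H"
    using n by (simp_all add: circulant_def hg_order_def circulant_edges_def)
  fix v assume "v \<in> verts ?H"
  then have "v < n" by (simp add: circulant_def)
  then show "total_distance (del_vert ?H v) = enat (hg_order ?H choose 2)"
  proof (induction v)
    case 0
    then show ?case using total_distance_circulant_del_0[OF n] by (simp add: circulant_def hg_order_def)
  next
    case (Suc v)
    have "isomorphic (del_vert ?H v) (del_vert ?H (succ_mod n v))"
      using Suc.prems succ_mod_bij[of n] succ_mod_circulant_edges[OF n]
      by (intro del_vert_automorphism H) (auto simp: circulant_def)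
    moreover have "succ_mod n v = Suc v" using Suc.prems by (simp add: succ_mod_def)
    ultimately have "total_distance (del_vert ?H v) = total_distance (del_vert ?H (Suc v))"
      using total_distance_isomorphic[OF hypergraph_del_vert[OF H] hypergraph_del_vert[OF H]] by metis
    then show ?case using Suc by simp
  qed
qed

section \<open>The possible orders\<close>

theorem theorem3:
  shows "(\<forall>H :: 'a hypergraph. soltes H \<longrightarrow> 5 \<le> hg_order H) \<and>
    (\<exists>H :: nat hypergraph. soltes H \<and> hg_order H = 5 \<and>
       (\<forall>G :: 'a hypergraph. soltes G \<and> hg_order G = 5 \<longrightarrow> isomorphic G H)) \<and>
    (\<forall>n\<ge>5. \<exists>H :: nat hypergraph. soltes H \<and> hg_order H = n)"
proof (intro conjI)
  show "\<forall>H :: 'a hypergraph. soltes H \<longrightarrow> 5 \<le> hg_order H"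
    using soltes_order_ge_5 by blast
  show "\<exists>H :: nat hypergraph. soltes H \<and> hg_order H = 5 \<and>
       (\<forall>G :: 'a hypergraph. soltes G \<and> hg_order G = 5 \<longrightarrow> isomorphic G H)"
    using soltes_pentagon pentagon_order soltes_order_5_isomorphic by blast
  show "\<forall>n\<ge>5. \<exists>H :: nat hypergraph. soltes H \<and> hg_order H = n"
  proof (intro allI impI)
    fix n :: nat assume "5 \<le> n"
    then consider "n = 5" | "n = 6" | "n = 7" | "8 \<le> n" by linarith
    then show "\<exists>H :: nat hypergraph. soltes H \<and> hg_order H = n"
    proof cases
      case 1
      then show ?thesis using soltes_pentagon pentagon_order by blast
    next
      case 2
      then show ?thesis using soltes_order_6 by simp
    next
      case 3
      then show ?thesis using soltes_order_7 by simp
    next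
      case 4
      then have "soltes (circulant n)" by (rule soltes_circulant)
      then show ?thesis
        by (intro exI[of _ "circulant n"]) (simp add: circulant_def hg_order_def)
    qed
  qed
qed

end
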